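(* Let $h\ge 0$ be an integer. If $h$ is odd, a basis of $Q_h^{(0)}M$ is represented by $$\{v_{h-4a-2,\,2a+1}: a\ge 0,\ h-4a-2\ge 0\}.$$ If $h$ is even, a basis of $Q_h^{(0)}M$ is represented by $$\{v_{h-4a,\,2a}: a\ge 0,\ h-4a\ge 0\},$$ together with the additional class $v_{0,h/2}$ when $h\equiv 2\pmod 4$.
   Context: Let $M=\widetilde H^*(MO(2);\mathbb F_2)$ be the reduced mod $2$ cohomology of the Thom space $MO(2)$ of the universal real two-plane bundle. Write $S=H^*(BO(2);\mathbb F_2)=\mathbb F_2[w_1,w_2]$ with $|w_1|=1$, $|w_2|=2$ (Stiefel--Whitney classes; by the splitting principle $S=\mathbb F_2[x,y]^{\mathfrak S_2}$ with $w_1=x+y$, $w_2=xy$, $|x|=|y|=1$). Then $M=uS$ is free over $S$ on the Thom class $u$ of degree $2$, and the Steenrod squares act on $M$ by the Cartan formula, the usual action on $S$, and the Thom identity $\mathrm{Sq}(u)=u(1+w_1+w_2)$ for the total square $\mathrm{Sq}=\sum_k \mathrm{Sq}^k$. For $n,m\ge 0$ let $v_{n,m}=u\,w_1^n w_2^m$. Its internal degree is $n+2m$ (its cohomological degree is $n+2m+2$). For $h\ge 0$ let $M_h=\mathrm{span}_{\mathbb F_2}\{v_{n,m}: n+2m=h\}$, and $M_d=0$ for $d<0$. Let $\mathcal A(0)$ be the subalgebra of the mod $2$ Steenrod algebra generated by $\mathrm{Sq}^1$, with augmentation ideal $\mathcal A(0)^+$ (its elements of positive degree). Put $Q_h^{(0)}M=M_h/(\mathcal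 A(0)^+M)_h$; equivalently $Q_h^{(0)}M=M_h/\operatorname{im}(\mathrm{Sq}^1:M_{h-1}\to M_h)$. A family in $M_h$ "represents a basis" if the classes of its members form a basis of the quotient. *)

theory Defs
  imports
    "HOL-Computational_Algebra.Polynomial"
    "HOL-Library.Z2"
begin

section \<open>The polynomial ring in two variables over the field with two elements\<close>

text \<open>
  The type below is \<open>F\<^sub>2[s][t]\<close>; the coefficient of \<open>s\<^sup>n t\<^sup>m\<close> in \<open>p\<close> is
  \<open>coeff (coeff p m) n\<close>. It serves as \<open>H\<^sup>*(BO(2)) = F\<^sub>2[w\<^sub>1, w\<^sub>2]\<close> (with \<open>s = w\<^sub>1\<close>, \<open>t = w\<^sub>2\<close>)
  and, in the splitting principle only, as \<open>F\<^sub>2[x, y]\<close> (with \<open>s = x\<close>, \<open>t = y\<close>).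
\<close>

type_synonym poly2 = "bit poly poly"

definition var1 :: poly2 where "var1 = [:[:0, 1:]:]"
definition var2 :: poly2 where "var2 = [:0, 1:]"

definition scale2 :: "bit \<Rightarrow> poly2 \<Rightarrow> poly2" where
  "scale2 c p = smult [:c:] p"

global_interpretation F2: vector_space scale2
proof unfold_locales
  show "scale2 1 p = p" for p
    unfolding scale2_def by (simp flip: one_pCons)
qed (simp_all add: scale2_def smult_add_right flip: smult_add_left)

text \<open>\<open>subst2 a b\<close> is the algebra endomorphism with \<open>var1 \<mapsto> a\<close> and \<open>var2 \<mapsto> b\<close>.\<close>

definition subst2 :: "poly2 \<Rightarrow> poly2 \<Rightarrow> poly2 \<Rightarrow> poly2" where
  "subst2 a b p = poly (map_poly (\<lambda>q. poly (map_poly (\<lambda>c. [:[:c:]:]) q) a) p) b"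

lemma map_poly_hom_mult:
  fixes f :: "'a::comm_semiring_0 \<Rightarrow> 'b::comm_semiring_0"
  assumes "f 0 = 0" "\<And>x y. f (x + y) = f x + f y" "\<And>x y. f (x * y) = f x * f y"
  shows "map_poly f (p * q) = map_poly f p * map_poly f q"
proof (rule poly_eqI)
  have sum: "f (sum g A) = (\<Sum>x\<in>A. f (g x))" if "finite A" for g and A :: "nat set"
    using that by (induction A) (auto simp: assms)
  show "coeff (map_poly f (p * q)) n = coeff (map_poly f p * map_poly f q) n" for n
    by (simp add: coeff_map_poly coeff_mult assms sum)
qed

lemma map_poly_hom_add:
  assumes "f 0 = 0" "\<And>x y. f (x + y) = f x + f y"
  shows "map_poly f (p + q) = map_poly f p + map_poly f q"
  by (rule poly_eqI) (simp add: coeff_map_poly assms)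

lemma subst2_0 [simp]: "subst2 a b 0 = 0"
  by (simp add: subst2_def)

lemma subst2_add: "subst2 a b (p + q) = subst2 a b p + subst2 a b q"
  unfolding subst2_def by (subst map_poly_hom_add) (auto simp: map_poly_hom_add)

lemma subst2_mult: "subst2 a b (p * q) = subst2 a b p * subst2 a b q"
  unfolding subst2_def
  by (subst map_poly_hom_mult) (auto simp: map_poly_hom_add map_poly_hom_mult)

lemma subst2_const [simp]: "subst2 a b [:[:c:]:] = [:[:c:]:]"
  by (simp add: subst2_def map_poly_pCons)

lemma subst2_1 [simp]: "subst2 a b 1 = 1"
  using subst2_const[of a b 1] by (simp add: one_pCons)

lemma subst2_var1 [simp]: "subst2 a b var1 = a"
  by (simp add: subst2_def var1_def map_poly_pCons flip: one_pCons)

lemma subst2_var2 [simp]: "subst2 a b var2 = b"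
  by (simp add: subst2_def var2_def map_poly_pCons flip: one_pCons)

lemma subst2_power: "subst2 a b (p ^ n) = subst2 a b p ^ n"
  by (induction n) (simp_all add: subst2_mult)

lemma poly2_hom_eqI:
  fixes f g :: "poly2 \<Rightarrow> poly2"
  assumes "\<And>c. f [:[:c:]:] = g [:[:c:]:]" "f var1 = g var1" "f var2 = g var2"
    and f: "\<And>p q. f (p + q) = f p + f q" "\<And>p q. f (p * q) = f p * f q"
    and g: "\<And>p q. g (p + q) = g p + g q" "\<And>p q. g (p * q) = g p * g q"
  shows "f p = g p"
proof -
  have const: "f [:q:] = g [:q:]" for q
  proof (induction q)
    case 0
    show ?case using assms(1)[of 0] by simp
  next
    case (pCons c q)
    have "[:pCons c q:] = [:[:c:]:] + var1 * [:q:]"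
      by (simp add: var1_def)
    then show ?case
      by (simp only: f g assms(1,2) pCons.IH)
  qed
  show ?thesis
  proof (induction p)
    case 0
    show ?case using const[of 0] by simp
  next
    case (pCons q p)
    have "pCons q p = [:q:] + var2 * p"
      by (simp add: var2_def)
    then show ?case
      by (simp only: f g assms(3) const pCons.IH)
  qed
qed


section \<open>Total Steenrod squares\<close>

abbreviation w1 :: poly2 where "w1 \<equiv> var1"
abbreviation w2 :: poly2 where "w2 \<equiv> var2"

text \<open>
  The total square of \<open>H\<^sup>*(BO(2))\<close> is the algebra endomorphism given on generators by the
  Wu formulas. By \<open>total_Sq_splitting\<close> this is the restriction, along \<open>w\<^sub>1 = x + y\<close>, \<open>w\<^sub>2 = x y\<close>,
  of the algebra endomorphism of \<open>F\<^sub>2[x, y]\<close> with \<open>x \<mapsto> x + x\<^sup>2\<close>, \<open>y \<mapsto> y + y\<^sup>2\<close>.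
\<close>

definition total_Sq_BO :: "poly2 \<Rightarrow> poly2" where
  "total_Sq_BO = subst2 (w1 + w1\<^sup>2) (w2 * (1 + w1 + w2))"

lemma poly2_two [simp]: "(2::poly2) = 0"
proof -
  have "b + b = 0" for b :: bit
    by (cases b) simp_all
  then have "(1::poly2) + 1 = 0"
    by (intro poly_eqI) (simp only: coeff_add coeff_0)
  then show ?thesis by simp
qed

lemma total_Sq_splitting:
  "subst2 (var1 + var2) (var1 * var2) (total_Sq_BO p) =
   subst2 (var1 + var1\<^sup>2) (var2 + var2\<^sup>2) (subst2 (var1 + var2) (var1 * var2) p)"
proof -
  let ?e = "subst2 (var1 + var2) (var1 * var2)"
  let ?Sq = "subst2 (var1 + var1\<^sup>2) (var2 + var2\<^sup>2)"
  show ?thesis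
  proof (rule poly2_hom_eqI[where f = "\<lambda>p. ?e (total_Sq_BO p)" and g = "\<lambda>p. ?Sq (?e p)"])
    show "?e (total_Sq_BO var1) = ?Sq (?e var1)"
      by (simp add: total_Sq_BO_def subst2_add subst2_power power2_sum)
    show "?e (total_Sq_BO var2) = ?Sq (?e var2)"
      by (simp add: total_Sq_BO_def subst2_add subst2_mult power2_eq_square distrib_left
          distrib_right mult_ac add_ac)
  qed (simp_all add: total_Sq_BO_def subst2_add subst2_mult)
qed

text \<open>
  The free module \<open>M = u F\<^sub>2[w\<^sub>1, w\<^sub>2]\<close> is represented by its coordinate with respect to the Thom
  class \<open>u\<close>: a term \<open>p :: MO2\<close> stands for \<open>u p\<close>. So \<open>total_Sq_MO p\<close> is the coordinate of
  \<open>Sq (u p) = Sq u \<cdot> Sq p = u (1 + w\<^sub>1 + w\<^sub>2) \<cdot> Sq p\<close>.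
\<close>

type_synonym MO2 = poly2

definition total_Sq_MO :: "MO2 \<Rightarrow> MO2" where
  "total_Sq_MO p = (1 + w1 + w2) * total_Sq_BO p"

text \<open>The basis element \<open>u w\<^sub>1\<^sup>n w\<^sub>2\<^sup>m\<close>, of internal degree \<open>n + 2 m\<close>.\<close>

definition v :: "nat \<Rightarrow> nat \<Rightarrow> MO2" where
  "v n m = w1 ^ n * w2 ^ m"

definition M :: "nat \<Rightarrow> MO2 set" where
  "M h = F2.span {v n m | n m. n + 2 * m = h}"

definition component :: "nat \<Rightarrow> MO2 \<Rightarrow> MO2" where
  "component h p = (\<Sum>(n, m) | n + 2 * m = h. scale2 (coeff (coeff p m) n) (v n m))"

text \<open>
  On an element of degree \<open>d\<close>, \<open>Sq\<^sup>k\<close> is the component of degree \<open>d + k\<close> of the total square. The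
  sum is finite, and internal degrees may be used in place of cohomological ones because
  they differ by the constant 2.
\<close>

definition Sq :: "nat \<Rightarrow> MO2 \<Rightarrow> MO2" where
  "Sq k p = (\<Sum>d | component d p \<noteq> 0. component (d + k) (total_Sq_MO (component d p)))"


section \<open>The indecomposable quotient\<close>

text \<open>
  \<open>steenrod_op K d\<close> holds of the operations on \<open>M\<close> by which the homogeneous elements of degree
  \<open>d\<close> of the subalgebra generated by the \<open>Sq\<^sup>k\<close>, \<open>k \<in> K\<close>, act. Closure under scalars is
  automatic over \<open>F\<^sub>2\<close>.
\<close>

inductive steenrod_op :: "nat set \<Rightarrow> nat \<Rightarrow> (MO2 \<Rightarrow> MO2) \<Rightarrow> bool" for K where
  gen: "k \<in> K \<Longrightarrow> steenrod_op K k (Sq k)"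
| one: "steenrod_op K 0 id"
| zero: "steenrod_op K d (\<lambda>_. 0)"
| add: "steenrod_op K d \<theta> \<Longrightarrow> steenrod_op K d \<phi> \<Longrightarrow> steenrod_op K d (\<lambda>p. \<theta> p + \<phi> p)"
| mult: "steenrod_op K d \<theta> \<Longrightarrow> steenrod_op K e \<phi> \<Longrightarrow> steenrod_op K (d + e) (\<theta> \<circ> \<phi>)"

text \<open>\<open>A(0)\<^sup>+ M\<close>, and its part of internal degree \<open>h\<close>.\<close>

definition A0_plus_M :: "MO2 set" where
  "A0_plus_M = F2.span {\<theta> p | d \<theta> p. steenrod_op {1} d \<theta> \<and> d > 0}"

definition A0_plus_M_deg :: "nat \<Rightarrow> MO2 set" where
  "A0_plus_M_deg h = A0_plus_M \<inter> M h"

definition coset :: "MO2 set \<Rightarrow> MO2 \<Rightarrow> MO2 set" where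
  "coset W p = {p + q | q. q \<in> W}"

definition quotient_space :: "MO2 set \<Rightarrow> MO2 set \<Rightarrow> MO2 set set" where
  "quotient_space V W = coset W ` V"

text \<open>
  With \<open>V = M h\<close> and \<open>W = A0_plus_M_deg h\<close>, the quotient \<open>V / W\<close> is \<open>Q\<^sub>h\<^sup>(\<^sup>0\<^sup>) M\<close>.
  The classes modulo \<open>W\<close> of the members of \<open>B\<close> form a basis of \<open>V / W\<close>. A linear combination of
  classes is the class of the corresponding linear combination of representatives;
  \<open>coset W 0\<close> is the zero of \<open>V / W\<close>. As the coefficients are indexed by the members of \<open>B\<close>,
  independence includes that distinct members have distinct classes.
\<close>

definition represents_basis :: "MO2 set \<Rightarrow> MO2 set \<Rightarrow> MO2 set \<Rightarrow> bool" where
  "represents_basis V W B \<longleftrightarrow>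
     B \<subseteq> V \<and>
     (\<forall>t c. finite t \<longrightarrow> t \<subseteq> B \<longrightarrow>
        coset W (\<Sum>b\<in>t. scale2 (c b) b) = coset W 0 \<longrightarrow> (\<forall>b\<in>t. c b = 0)) \<and>
     (\<forall>X\<in>quotient_space V W. \<exists>t c. finite t \<and> t \<subseteq> B \<and>
        X = coset W (\<Sum>b\<in>t. scale2 (c b) b))"

end

theory Submission
  imports Defs
begin

text \<open>
  By the Cartan formula \<open>Sq\<^sup>1 v\<^sub>n\<^sub>,\<^sub>m = (n + m + 1) v\<^sub>n\<^sub>+\<^sub>1\<^sub>,\<^sub>m\<close>. Hence the image of \<open>Sq\<^sup>1\<close> is spanned by the
  monomials \<open>v\<^sub>n\<^sub>,\<^sub>m\<close> with \<open>n > 0\<close> and \<open>n + m\<close> odd, and the remaining monomials of degree \<open>h\<close>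
  represent a basis of the quotient.
\<close>

section \<open>Monomial coordinates and subspaces spanned by monomials\<close>

definition coeff2 :: "poly2 \<Rightarrow> nat \<Rightarrow> nat \<Rightarrow> bit" where
  "coeff2 p n m = coeff (coeff p m) n"

lemma coeff2_0 [simp]: "coeff2 0 n m = 0"
  and coeff2_add [simp]: "coeff2 (p + q) n m = coeff2 p n m + coeff2 q n m"
  and coeff2_diff [simp]: "coeff2 (p - q) n m = coeff2 p n m - coeff2 q n m"
  and coeff2_scale2 [simp]: "coeff2 (scale2 c p) n m = c * coeff2 p n m"
  by (simp_all add: coeff2_def scale2_def)

lemma coeff2_sum: "coeff2 (sum f A) n m = (\<Sum>a\<in>A. coeff2 (f a) n m)"
  by (simp add: coeff2_def coeff_sum)

lemma poly2_eqI: "(\<And>n m. coeff2 p n m = coeff2 q n m) \<Longrightarrow> p = q"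
  by (simp add: coeff2_def poly_eqI)

lemma v_eq_monom: "v n m = monom (monom 1 n) m"
proof -
  have "w1 ^ n = [:monom 1 n:]"
    by (induction n) (simp_all add: var1_def monom_Suc one_pCons)
  moreover have "w2 ^ m = monom 1 m"
    by (induction m) (simp_all add: var2_def monom_Suc)
  ultimately show ?thesis
    by (simp add: v_def smult_monom)
qed

lemma coeff2_v: "coeff2 (v n m) i j = (if n = i \<and> m = j then 1 else 0)"
  by (simp add: coeff2_def v_eq_monom)

lemma coeff2_mult_v:
  "coeff2 (p * v n m) i j = (if n \<le> i \<and> m \<le> j then coeff2 p (i - n) (j - m) else 0)"
  by (simp add: coeff2_def v_eq_monom mult.commute[of p] coeff_monom_mult)

lemma v_inject [simp]: "v n m = v n' m' \<longleftrightarrow> n = n' \<and> m = m'"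
  using coeff2_v[of n m n m] coeff2_v[of n' m' n m] by (metis one_neq_zero)

lemma finite_support2: "finite {(n, m). coeff2 p n m \<noteq> 0}"
proof (rule finite_subset)
  show "{(n, m). coeff2 p n m \<noteq> 0} \<subseteq>
      (\<lambda>(m, n). (n, m)) ` (SIGMA m:{..degree p}. {..degree (coeff p m)})"
    unfolding coeff2_def
    by (auto simp: image_iff intro!: le_degree)
qed auto

lemma coeff2_sum_v:
  assumes "finite S"
  shows "coeff2 (\<Sum>(n, m)\<in>S. scale2 (f n m) (v n m)) i j = (if (i, j) \<in> S then f i j else 0)"
proof -
  have "coeff2 (\<Sum>(n, m)\<in>S. scale2 (f n m) (v n m)) i j =
      (\<Sum>s\<in>S. if s = (i, j) then f i j else 0)"
    unfolding coeff2_sum by (intro sum.cong) (auto simp: coeff2_v split: if_splits)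
  also have "\<dots> = (if (i, j) \<in> S then f i j else 0)"
    using assms by simp
  finally show ?thesis .
qed

text \<open>\<open>M h\<close> and \<open>A0_plus_M\<close> are both spanned by monomials. Recording
  such a subspace by its set of exponent pairs turns membership into a condition on coefficients and
  intersection of subspaces into intersection of index sets.\<close>

definition supported_on :: "(nat \<times> nat) set \<Rightarrow> poly2 set" where
  "supported_on I = {p. \<forall>n m. coeff2 p n m \<noteq> 0 \<longrightarrow> (n, m) \<in> I}"

lemma supported_on_eq_span: "supported_on I = F2.span {v n m | n m. (n, m) \<in> I}"
proof
  show "supported_on I \<subseteq> F2.span {v n m | n m. (n, m) \<in> I}"
  proof
    fix p assume p: "p \<in> supported_on I"
    define S where "S = {(n, m). coeff2 p n m \<noteq> 0}"
    have "p = (\<Sum>(n, m)\<in>S. scale2 (coeff2 p n m) (v n m))"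
      unfolding S_def by (rule poly2_eqI, subst coeff2_sum_v[OF finite_support2]) auto
    also have "\<dots> \<in> F2.span {v n m | n m. (n, m) \<in> I}"
      using p
      by (intro F2.span_sum)
        (auto simp: S_def supported_on_def intro!: F2.span_scale F2.span_base)
    finally show "p \<in> F2.span {v n m | n m. (n, m) \<in> I}" .
  qed
next
  show "F2.span {v n m | n m. (n, m) \<in> I} \<subseteq> supported_on I"
    by (intro F2.span_minimal F2.subspaceI)
      (auto simp: supported_on_def coeff2_v split: if_splits)
qed

lemma subspace_supported_on: "F2.subspace (supported_on I)"
  by (simp add: supported_on_eq_span)

lemma M_eq_supported_on: "M h = supported_on {(n, m). n + 2 * m = h}"
  by (simp add: M_def supported_on_eq_span)

section \<open>The action of Sq^1 on monomials\<close>

lemma coeff2_component: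
  "coeff2 (component h p) n m = (if n + 2 * m = h then coeff2 p n m else 0)"
proof -
  \<comment> \<open>Finiteness of the index set keeps the sum in \<open>component\<close> from
    taking the default value 0.\<close>
  have "{(n, m). n + 2 * m = h} \<subseteq> {..h} \<times> {..h}"
    by auto
  then have "finite {(n, m). n + 2 * m = h}"
    by (rule finite_subset) simp
  then show ?thesis
    by (simp add: component_def coeff2_sum_v flip: coeff2_def)
qed

lemma component_0 [simp]: "component h 0 = 0"
  and component_add: "component h (p + q) = component h p + component h q"
  by (simp_all add: poly2_eqI coeff2_component)

lemma component_v: "component h (v n m) = (if n + 2 * m = h then v n m else 0)"
  by (rule poly2_eqI) (auto simp: coeff2_component coeff2_v)

lemma total_Sq_MO_0 [simp]: "total_Sq_MO 0 = 0"
  and total_Sq_MO_add: "total_Sq_MO (p + q) = total_Sq_MO p + total_Sq_MO q"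
  by (simp_all add: total_Sq_MO_def total_Sq_BO_def subst2_add distrib_left)

lemma of_nat_poly2: "(of_nat n :: poly2) = (if even n then 0 else 1)"
  by (induction n) simp_all

text \<open>Modulo the ideal generated by \<open>w1\<^sup>2\<close> and \<open>w2\<close>, both
  factors equal \<open>1 + w1\<close>, so the product is \<open>(1 + w1) ^ (n + m)\<close>, of which
  only the linear part remains. Both generators of the ideal have degree 2, so the error terms
  cannot affect degree 1.\<close>

lemma first_order_expansion:
  "\<exists>a b. (1 + w1) ^ n * (1 + w1 + w2) ^ m = 1 + of_nat (n + m) * w1 + a * w1\<^sup>2 + b * w2"
proof (induction n)
  case 0
  show ?case
  proof (induction m)
    case 0
    show ?case by (auto intro!: exI[of _ 0])
  next
    case (Suc m)
    then obtain a b where "(1 + w1 + w2) ^ m = 1 + of_nat m * w1 + a * w1\<^sup>2 + b * w2"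
      by auto
    \<comment> \<open>Every product with a factor \<open>w2\<close> is collected in the last
      coefficient, the other products of order at least two in \<open>w1\<close> in the one before
      it.\<close>
    then have "(1 + w1 + w2) ^ Suc m =
        1 + of_nat (Suc m) * w1 + (of_nat m + a + a * w1) * w1\<^sup>2 +
        (b * (1 + w1 + w2) + 1 + of_nat m * w1 + a * w1\<^sup>2) * w2"
      by (simp add: power2_eq_square algebra_simps)
    then show ?case by auto
  qed
next
  case (Suc n)
  then obtain a b where
    "(1 + w1) ^ n * (1 + w1 + w2) ^ m = 1 + of_nat (n + m) * w1 + a * w1\<^sup>2 + b * w2"
    by auto
  then have "(1 + w1) ^ Suc n * (1 + w1 + w2) ^ m =
      (1 + w1) * (1 + of_nat (n + m) * w1 + a * w1\<^sup>2 + b * w2)"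
    by (simp add: mult.assoc)
  also have "\<dots> = 1 + of_nat (Suc n + m) * w1 + (of_nat (n + m) + a + a * w1) * w1\<^sup>2 +
      (b * (1 + w1)) * w2"
    by (simp add: power2_eq_square algebra_simps)
  finally show ?case by blast
qed

lemma component_total_Sq_v:
  "component (n + 2 * m + 1) (total_Sq_MO (v n m)) = (if even (n + m) then v (n + 1) m else 0)"
proof -
  \<comment> \<open>The exponent is \<open>Suc m\<close> because the Thom class contributes one more
    factor \<open>1 + w1 + w2\<close>.\<close>
  obtain a b where ab: "(1 + w1) ^ n * (1 + w1 + w2) ^ Suc m =
      1 + of_nat (n + Suc m) * w1 + a * w1\<^sup>2 + b * w2"
    using first_order_expansion by blast
  have "w1 + w1\<^sup>2 = w1 * (1 + w1)"
    by (simp add: power2_eq_square distrib_left)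
  then have "total_Sq_MO (v n m) = v n m * ((1 + w1) ^ n * (1 + w1 + w2) ^ Suc m)"
    by (simp add: total_Sq_MO_def total_Sq_BO_def v_def subst2_mult subst2_power
        power_mult_distrib mult_ac)
  also have "\<dots> = v n m + of_nat (n + Suc m) * v (n + 1) m + a * v (n + 2) m + b * v n (m + 1)"
    unfolding ab by (simp add: v_def power_add power2_eq_square algebra_simps)
  \<comment> \<open>The coefficient is n + m + 1 modulo 2, hence 1 exactly when n + m is
    even.\<close>
  also have "of_nat (n + Suc m) * v (n + 1) m = (if even (n + m) then v (n + 1) m else 0)"
    by (simp only: of_nat_poly2) simp
  \<comment> \<open>The first term has degree n + 2m, and multiples of \<open>v (n + 2) m\<close>
    and \<open>v n (m + 1)\<close> start in degree n + 2m + 2. Only the linear term meets degree n +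
    2m + 1.\<close>
  finally show ?thesis
    by (auto intro!: poly2_eqI simp: coeff2_component coeff2_v coeff2_mult_v split: if_splits)
qed

lemma Sq_1_v: "Sq 1 (v n m) = (if even (n + m) then v (n + 1) m else 0)"
proof -
  have "v n m \<noteq> 0"
    using coeff2_v[of n m n m] by auto
  then have "{d. component d (v n m) \<noteq> 0} = {n + 2 * m}"
    by (auto simp: component_v)
  then show ?thesis
    using component_total_Sq_v[of n m] by (simp add: Sq_def component_v)
qed

section \<open>The submodule generated by operations of positive degree\<close>

definition Sq1_support :: "(nat \<times> nat) set" where
  "Sq1_support = {(n, m). 0 < n \<and> odd (n + m)}"

text \<open>\<open>Sq 1 p\<close> is a sum over the degrees occurring in \<open>p\<close>. Each
  summand comes from a map that is linear on \<open>M d\<close>, so it suffices to check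
  monomials.\<close>

lemma Sq_1_in_supported_on: "Sq 1 p \<in> supported_on Sq1_support"
proof -
  have "component (d + 1) (total_Sq_MO q) \<in> supported_on Sq1_support" if "q \<in> M d" for d q
    using that unfolding M_def
  proof (rule F2.span_induct)
    show "F2.subspace {q. component (d + 1) (total_Sq_MO q) \<in> supported_on Sq1_support}"
    proof (rule F2.subspaceI)
      \<comment> \<open>Over the field with two elements, compatibility with scalars reduces to the
        scalars 0 and 1.\<close>
      fix c q assume "q \<in> {q. component (d + 1) (total_Sq_MO q) \<in> supported_on Sq1_support}"
      then show "scale2 c q \<in> {q. component (d + 1) (total_Sq_MO q) \<in> supported_on Sq1_support}"
        using F2.subspace_0[OF subspace_supported_on] by (cases c) auto
    qed (simp_all add: component_add total_Sq_MO_add F2.subspace_0 F2.subspace_add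
        subspace_supported_on)
  next
    fix q assume "q \<in> {v n m |n m. n + 2 * m = d}"
    then obtain n m where "q = v n m" "n + 2 * m = d" by blast
    then show "component (d + 1) (total_Sq_MO q) \<in> supported_on Sq1_support"
      using component_total_Sq_v[of n m]
      by (auto simp: supported_on_def Sq1_support_def coeff2_v split: if_splits)
  qed
  moreover have "component d p \<in> M d" for d
    by (auto simp: M_eq_supported_on supported_on_def coeff2_component split: if_splits)
  ultimately show ?thesis
    unfolding Sq_def by (intro F2.subspace_sum[OF subspace_supported_on]) blast
qed

text \<open>The clause for degree 0 carries the induction through products: if the outer factor has
  positive degree, its values already lie in the subspace; otherwise it is a scalar and preserves
  the values of the inner one.\<close>

lemma steenrod_op_A0_cases:
  "steenrod_op {1} d \<theta> \<Longrightarrow>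
   (if d = 0 then \<exists>c. \<forall>p. \<theta> p = scale2 c p else \<forall>p. \<theta> p \<in> supported_on Sq1_support)"
proof (induction rule: steenrod_op.induct)
  case (gen k)
  then show ?case using Sq_1_in_supported_on by simp
next
  case one
  then show ?case by (auto intro!: exI[of _ 1])
next
  case (zero d)
  then show ?case
    by (auto intro!: exI[of _ 0] F2.subspace_0 subspace_supported_on)
next
  case (add d \<theta> \<phi>)
  then show ?case
    by (auto split: if_splits intro: F2.subspace_add subspace_supported_on
        simp flip: F2.scale_left_distrib)
next
  case (mult d \<theta> e \<phi>)
  then show ?case
    by (auto split: if_splits intro: F2.subspace_scale subspace_supported_on)
qed

lemma A0_plus_M_eq_supported_on: "A0_plus_M = supported_on Sq1_support"
proof
  show "A0_plus_M \<subseteq> supported_on Sq1_support"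
    unfolding A0_plus_M_def
    using steenrod_op_A0_cases
    by (intro F2.span_minimal subspace_supported_on) fastforce
next
  have "v n m \<in> A0_plus_M" if nm: "(n, m) \<in> Sq1_support" for n m
  proof -
    \<comment> \<open>Lowering the positive exponent of \<open>w1\<close> by one makes the exponent
      sum even, so Sq^1 maps the smaller monomial onto \<open>v n m\<close>.\<close>
    from nm obtain n' where "n = n' + 1" "even (n' + m)"
      by (cases n) (auto simp: Sq1_support_def)
    then have "v n m = Sq 1 (v n' m)"
      using Sq_1_v[of n' m] by simp
    moreover have "steenrod_op {1} 1 (Sq 1)"
      by (rule steenrod_op.gen) simp
    ultimately show ?thesis
      unfolding A0_plus_M_def by (intro F2.span_base) blast
  qed
  then show "supported_on Sq1_support \<subseteq> A0_plus_M"
    unfolding supported_on_eq_span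
    by (intro F2.span_minimal) (auto simp: A0_plus_M_def)
qed

section \<open>Quotients by subspaces spanned by monomials\<close>

lemma coset_eq_iff:
  assumes "F2.subspace W"
  shows "coset W p = coset W q \<longleftrightarrow> p - q \<in> W"
proof
  assume "coset W p = coset W q"
  moreover have "p \<in> coset W p"
    using F2.subspace_0[OF assms] by (force simp: coset_def)
  ultimately show "p - q \<in> W"
    by (auto simp: coset_def)
next
  have sub: "coset W p \<subseteq> coset W q" if "p - q \<in> W" for p q
  proof
    fix x assume "x \<in> coset W p"
    then obtain r where "r \<in> W" "x = p + r" by (auto simp: coset_def)
    then have "x = q + (p - q + r)" "p - q + r \<in> W"
      using that F2.subspace_add[OF assms] by auto
    then show "x \<in> coset W q" by (auto simp only: coset_def)
  qed
  assume "p - q \<in> W"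
  moreover from this have "q - p \<in> W"
    using F2.subspace_neg[OF assms] by force
  ultimately show "coset W p = coset W q"
    using sub by blast
qed

text \<open>The quotient kills exactly the monomials indexed by \<open>J\<close>. Coefficients
  outside \<open>J\<close> are well defined on classes, which gives independence; discarding the
  terms in \<open>J\<close> gives spanning.\<close>

lemma represents_basis_monomials:
  "represents_basis (supported_on I) (supported_on (I \<inter> J)) {v n m | n m. (n, m) \<in> I - J}"
  (is "represents_basis ?V ?W ?B")
  unfolding represents_basis_def
proof (intro conjI allI impI ballI)
  show "?B \<subseteq> ?V"
    by (auto simp: supported_on_eq_span intro: F2.span_base)
next
  fix t c b
  assume t: "finite t" "t \<subseteq> ?B" and b: "b \<in> t"
    and eq: "coset ?W (\<Sum>b\<in>t. scale2 (c b) b) = coset ?W 0"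
  from t b obtain n m where nm: "b = v n m" "(n, m) \<in> I - J" by blast
  \<comment> \<open>Members of \<open>t\<close> are distinct monomials, so the coefficient at the
    exponents of \<open>b\<close> isolates \<open>c b\<close>.\<close>
  have "coeff2 (\<Sum>b\<in>t. scale2 (c b) b) n m = (\<Sum>b'\<in>t. if b' = b then c b else 0)"
    unfolding coeff2_sum
  proof (rule sum.cong)
    fix b' assume "b' \<in> t"
    with t obtain n' m' where "b' = v n' m'" by blast
    with nm show "coeff2 (scale2 (c b') b') n m = (if b' = b then c b else 0)"
      by (simp add: coeff2_v)
  qed simp
  also have "\<dots> = c b"
    using t b by simp
  finally have "coeff2 (\<Sum>b\<in>t. scale2 (c b) b) n m = c b" .
  moreover have "(\<Sum>b\<in>t. scale2 (c b) b) \<in> ?W"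
    using eq by (simp add: coset_eq_iff subspace_supported_on)
  ultimately have "c b \<noteq> 0 \<Longrightarrow> (n, m) \<in> I \<inter> J"
    unfolding supported_on_def mem_Collect_eq by metis
  with nm show "c b = 0"
    by blast
next
  fix X assume "X \<in> quotient_space ?V ?W"
  then obtain p where p: "p \<in> ?V" and X: "X = coset ?W p"
    by (auto simp: quotient_space_def)
  \<comment> \<open>Here \<open>q\<close> will be \<open>p\<close> with its terms in
    \<open>J\<close> removed, so that \<open>p - q\<close> lies in the subspace divided out.\<close>
  define S where "S = {(n, m). coeff2 p n m \<noteq> 0} - J"
  define q where "q = (\<Sum>(n, m)\<in>S. scale2 (coeff2 p n m) (v n m))"
  have q: "coeff2 q n m = (if (n, m) \<in> J then 0 else coeff2 p n m)" for n m
    using finite_support2 unfolding q_def S_def by (subst coeff2_sum_v) (blast, auto)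
  have "q \<in> supported_on (I - J)"
    using p by (auto simp: q supported_on_def split: if_splits)
  then have "q \<in> F2.span ?B"
    by (simp only: supported_on_eq_span)
  then obtain t c where "finite t" "t \<subseteq> ?B" "q = (\<Sum>b\<in>t. scale2 (c b) b)"
    by (auto simp: F2.span_explicit)
  moreover have "p - q \<in> ?W"
    using p by (auto simp: q supported_on_def split: if_splits)
  then have "X = coset ?W q"
    by (simp add: X coset_eq_iff subspace_supported_on)
  ultimately show "\<exists>t c. finite t \<and> t \<subseteq> ?B \<and> X = coset ?W (\<Sum>b\<in>t. scale2 (c b) b)"
    by blast
qed

section \<open>The surviving exponents in a fixed degree\<close>

theorem theorem4p1:
  fixes h :: nat
  shows "(odd h \<longrightarrow>
            represents_basis (M h) (A0_plus_M_deg h)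
              {v (h - 4 * a - 2) (2 * a + 1) | a. 4 * a + 2 \<le> h}) \<and>
         (even h \<longrightarrow>
            represents_basis (M h) (A0_plus_M_deg h)
              ({v (h - 4 * a) (2 * a) | a. 4 * a \<le> h} \<union>
               (if h mod 4 = 2 then {v 0 (h div 2)} else {})))"
proof -
  let ?I = "{(n, m). n + 2 * m = h}"
  have "A0_plus_M_deg h = supported_on (?I \<inter> Sq1_support)"
    by (auto simp: A0_plus_M_deg_def A0_plus_M_eq_supported_on M_eq_supported_on supported_on_def)
  then have basis: "represents_basis (M h) (A0_plus_M_deg h)
      {v n m | n m. (n, m) \<in> ?I - Sq1_support}"
    by (simp only: M_eq_supported_on represents_basis_monomials)
  have odd: "{v n m | n m. (n, m) \<in> ?I - Sq1_support} =
      {v (h - 4 * a - 2) (2 * a + 1) | a. 4 * a + 2 \<le> h}" if "odd h"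
  proof -
    have "(\<exists>n m. x = v n m \<and> (n, m) \<in> ?I - Sq1_support) \<longleftrightarrow>
        (\<exists>a. x = v (h - 4 * a - 2) (2 * a + 1) \<and> 4 * a + 2 \<le> h)" for x
    proof
      assume "\<exists>n m. x = v n m \<and> (n, m) \<in> ?I - Sq1_support"
      then obtain n m where *: "x = v n m" "n + 2 * m = h" "n = 0 \<or> even (n + m)"
        by (auto simp: Sq1_support_def)
      \<comment> \<open>Odd \<open>h\<close> forces \<open>n\<close> odd, hence nonzero, so n + m is
        even.\<close>
      with that have "odd m" by auto
      then obtain a where "m = 2 * a + 1" by (elim oddE)
      with * show "\<exists>a. x = v (h - 4 * a - 2) (2 * a + 1) \<and> 4 * a + 2 \<le> h"
        by (intro exI[of _ a]) auto
    next
      assume "\<exists>a. x = v (h - 4 * a - 2) (2 * a + 1) \<and> 4 * a + 2 \<le> h"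
      then obtain a where a: "x = v (h - 4 * a - 2) (2 * a + 1)" "4 * a + 2 \<le> h"
        by blast
      \<comment> \<open>The bound on \<open>a\<close> makes the truncated subtraction exact. Both
        exponents are odd, so their sum is even.\<close>
      have "(h - 4 * a - 2, 2 * a + 1) \<in> ?I - Sq1_support"
        using that a by (auto simp: Sq1_support_def)
      with a show "\<exists>n m. x = v n m \<and> (n, m) \<in> ?I - Sq1_support" by blast
    qed
    then show ?thesis by blast
  qed
  have even: "{v n m | n m. (n, m) \<in> ?I - Sq1_support} =
      {v (h - 4 * a) (2 * a) | a. 4 * a \<le> h} \<union>
      (if h mod 4 = 2 then {v 0 (h div 2)} else {})" if "even h"
  proof -
    have "(\<exists>n m. x = v n m \<and> (n, m) \<in> ?I - Sq1_support) \<longleftrightarrow>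
        (\<exists>a. x = v (h - 4 * a) (2 * a) \<and> 4 * a \<le> h) \<or>
        h mod 4 = 2 \<and> x = v 0 (h div 2)" for x
    proof
      assume "\<exists>n m. x = v n m \<and> (n, m) \<in> ?I - Sq1_support"
      then obtain n m where *: "x = v n m" "n + 2 * m = h" "n = 0 \<or> even (n + m)"
        by (auto simp: Sq1_support_def)
      show "(\<exists>a. x = v (h - 4 * a) (2 * a) \<and> 4 * a \<le> h) \<or> h mod 4 = 2 \<and> x = v 0 (h div 2)"
      proof (cases "even m")
        case True
        then obtain a where "m = 2 * a" by (elim evenE)
        with * show ?thesis
          by (intro disjI1 exI[of _ a]) auto
      next
        case False
        \<comment> \<open>Even \<open>h\<close> makes \<open>n\<close> even, so n + m is odd and
          only the alternative \<open>n = 0\<close> remains. Then h = 2m with \<open>m\<close>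
          odd.\<close>
        with * that have "n = 0" by auto
        moreover from False obtain a where "m = 2 * a + 1" by (elim oddE)
        ultimately have "h mod 4 = 2"
          using * by presburger
        then show ?thesis using * \<open>n = 0\<close> by auto
      qed
    next
      assume "(\<exists>a. x = v (h - 4 * a) (2 * a) \<and> 4 * a \<le> h) \<or> h mod 4 = 2 \<and> x = v 0 (h div 2)"
      then show "\<exists>n m. x = v n m \<and> (n, m) \<in> ?I - Sq1_support"
      proof
        assume "\<exists>a. x = v (h - 4 * a) (2 * a) \<and> 4 * a \<le> h"
        then obtain a where a: "x = v (h - 4 * a) (2 * a)" "4 * a \<le> h"
          by blast
        have "(h - 4 * a, 2 * a) \<in> ?I - Sq1_support"
          using that a by (auto simp: Sq1_support_def)
        with a show ?thesis by blast
      next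
        assume "h mod 4 = 2 \<and> x = v 0 (h div 2)"
        \<comment> \<open>A monomial without \<open>w1\<close> is never in the image. For h
          congruent to 2 modulo 4 its exponent of \<open>w2\<close> is odd, so the first family
          misses it.\<close>
        moreover have "(0, h div 2) \<in> ?I - Sq1_support"
          using that by (auto simp: Sq1_support_def)
        ultimately show ?thesis by (intro exI conjI) auto
      qed
    qed
    then show ?thesis by (cases "h mod 4 = 2") auto
  qed
  show ?thesis
  proof (cases "even h")
    case True
    with basis[unfolded even[OF True]] show ?thesis by blast
  next
    case False
    with basis[unfolded odd[OF False]] show ?thesis by blast
  qed
qed

end
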